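(* Let $\alpha\in(-1/2,0)$, let $n\ge1$, and suppose $\alpha_j\in(-1,\alpha)$ for $j=0,1,\ldots,n-2$ and $\alpha_{n-1}=\alpha$. Let $\theta_\alpha=2\arcsin|\alpha|$ and let $W_\alpha=\{re^{i\theta}:0\le r<1,\ \theta\in(-\theta_\alpha,\theta_\alpha)\}$ be the sector of the unit disk subtending the arc $(-\theta_\alpha,\theta_\alpha)$. Then $\Phi_n(z)$ has no zeros in $W_\alpha$.
   Context: The monic orthogonal polynomials on the unit circle with Verblunsky coefficients $\alpha_0,\alpha_1,\dots$ in the open unit disk are defined by $\Phi_0=1$ and the Szegő recursion $\Phi_{m+1}(z)=z\Phi_m(z)-\overline{\alpha}_m\Phi_m^*(z)$, where $\Phi_m^*(z)=z^m\overline{\Phi_m(1/\bar z)}$; in particular $\Phi_n$ depends only on $\alpha_0,\dots,\alpha_{n-1}$. An arc $(-\theta_\alpha,\theta_\alpha)$ denotes $\{e^{i\theta}:\theta\in(-\theta_\alpha,\theta_\alpha)\}$. *)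

theory Defs
  imports Complex_Main "HOL-Computational_Algebra.Polynomial"
begin

text \<open>
  For \<open>degree p \<le> m\<close>, \<open>rev_star m p\<close> is the polynomial \<open>p\<^sup>*(z) = z\<^sup>m cnj (p (1 / cnj z))\<close>;
  see \<open>poly_rev_star\<close>. It is given through its coefficients, because that formula only makes sense
  for \<open>z \<noteq> 0\<close>. The index \<open>m\<close> is explicit since \<open>p\<^sup>*\<close> depends on it.
\<close>

definition rev_star :: "nat \<Rightarrow> complex poly \<Rightarrow> complex poly" where
  "rev_star m p = (\<Sum>k\<le>m. monom (cnj (coeff p (m - k))) k)"

primrec OPUC :: "(nat \<Rightarrow> complex) \<Rightarrow> nat \<Rightarrow> complex poly" where
  "OPUC a 0 = 1"
| "OPUC a (Suc m) = pCons 0 (OPUC a m) - smult (cnj (a m)) (rev_star m (OPUC a m))"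

definition disk_sector :: "real \<Rightarrow> complex set" where
  "disk_sector t = {rcis r \<theta> | r \<theta>. 0 \<le> r \<and> r < 1 \<and> \<theta> \<in> {-t<..<t}}"

lemma poly_rev_star:
  assumes "degree p \<le> m" and "z \<noteq> 0"
  shows "poly (rev_star m p) z = z ^ m * cnj (poly p (1 / cnj z))"
proof -
  have pad: "poly p x = (\<Sum>k\<le>m. coeff p k * x ^ k)" for x
    unfolding poly_altdef using assms(1)
    by (intro sum.mono_neutral_left) (auto simp: coeff_eq_0)
  have "z ^ m * cnj (poly p (1 / cnj z)) = (\<Sum>k\<le>m. z ^ m * (cnj (coeff p k) * (1 / z) ^ k))"
    by (simp add: pad sum_distrib_left)
  also have "\<dots> = (\<Sum>k\<le>m. cnj (coeff p k) * z ^ (m - k))"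
    using assms(2) by (intro sum.cong) (auto simp: power_diff power_divide)
  also have "\<dots> = (\<Sum>k\<le>m. cnj (coeff p (m - k)) * z ^ k)"
    by (rule sum.reindex_bij_witness[of _ "\<lambda>k. m - k" "\<lambda>k. m - k"]) auto
  finally show ?thesis
    by (simp add: rev_star_def poly_sum poly_monom)
qed

lemma degree_rev_star: "degree (rev_star m p) \<le> m"
  unfolding rev_star_def
  by (intro degree_sum_le) (auto intro: order_trans[OF degree_monom_le])

lemma OPUC_monic: "degree (OPUC a m) = m \<and> lead_coeff (OPUC a m) = 1"
proof (induction m)
  case (Suc m)
  have ne: "OPUC a m \<noteq> 0" using Suc by auto
  have "coeff (rev_star m (OPUC a m)) (Suc m) = 0"
    using degree_rev_star[of m "OPUC a m"] by (intro coeff_eq_0) simp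
  then have c: "coeff (OPUC a (Suc m)) (Suc m) = 1" using Suc by auto
  have "degree (OPUC a (Suc m)) \<le> Suc m"
    using Suc ne degree_rev_star[of m "OPUC a m"] degree_smult_le[of "cnj (a m)" "rev_star m (OPUC a m)"]
    by (auto intro!: degree_diff_le simp del: degree_smult_eq)
  moreover have "degree (OPUC a (Suc m)) \<ge> Suc m"
    by (rule le_degree) (use c in simp)
  ultimately have d: "degree (OPUC a (Suc m)) = Suc m" by (rule antisym)
  show ?case unfolding d using c by blast
qed simp

lemma OPUC_Szego_recursion:
  assumes "z \<noteq> 0"
  shows "poly (OPUC a (Suc m)) z =
    z * poly (OPUC a m) z - cnj (a m) * (z ^ m * cnj (poly (OPUC a m) (1 / cnj z)))"
  using poly_rev_star[OF _ assms, of "OPUC a m" m] OPUC_monic[of a m] by simp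

end

theory Submission
  imports Defs
begin

text \<open>
  For real Verblunsky coefficients \<open>\<alpha>\<^sub>m = - c\<^sub>m\<close>, the Szego recursion and its reversed form
  become one Moebius recursion for \<open>g\<^sub>m(z) = z \<Phi>\<^sub>m(z) / \<Phi>\<^sub>m\<^sup>*(z)\<close>:
  \<open>g\<^sub>0 = z\<close> and \<open>g\<^sub>m\<^sub>+\<^sub>1 = z (g\<^sub>m + c\<^sub>m) / (1 + c\<^sub>m g\<^sub>m)\<close>.
  With \<open>s = \<bar>\<alpha>\<bar>\<close>, one also has \<open>\<Phi>\<^sub>n = \<Phi>\<^sub>n\<^sub>-\<^sub>1\<^sup>* (g\<^sub>n\<^sub>-\<^sub>1 + s)\<close>,
  so a zero of \<open>\<Phi>\<^sub>n\<close> in the disk is a point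
  where \<open>g\<^sub>n\<^sub>-\<^sub>1 = - s\<close>. This is excluded by showing that the cap \<open>\<bar>w\<bar> < 1, Re w > - s\<close> is
  invariant under the recursion for every fixed \<open>z\<close> in the sector, which needs two facts.

  The hyperbolic translation \<open>w \<mapsto> (w + s) / (1 + s w)\<close> carries the line \<open>Re w = - s\<close> to the circle
  with diameter \<open>[0, 1/s]\<close>, that is, \<open>Re v = s \<bar>v\<bar>\<^sup>2\<close>; a larger \<open>c\<close> pushes the cap still
  further towards \<open>1\<close>. So each translation maps the cap into the lens \<open>\<bar>v\<bar> \<le> 1\<close>,
  \<open>Re v \<ge> s \<bar>v\<bar>\<^sup>2\<close> (\<open>translation_maps_cap\<close>).

  Multiplication by a point of the sector brings this lens back into the cap
  (\<open>sector_times_lens_in_cap\<close>). The opening \<open>2 arcsin s\<close> is exactly critical: turning the corner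
  \<open>exp (i arccos s)\<close> of the lens through that angle gives \<open>exp (i arccos (- s))\<close>, the corner of the cap.
  That no other point of the lens does worse is the inequality between arithmetic and geometric means.
\<close>

lemma coeff_rev_star: "coeff (rev_star m p) k = (if k \<le> m then cnj (coeff p (m - k)) else 0)"
  by (simp add: rev_star_def coeff_sum)

lemma rev_star_Szego_step:
  assumes "degree p \<le> m"
  shows "rev_star (Suc m) (pCons 0 p - smult c (rev_star m p))
    = rev_star m p - smult (cnj c) (pCons 0 p)"
proof (rule poly_eqI)
  fix k
  have "coeff p k = 0" if "k > m" for k
    using assms that by (intro coeff_eq_0) simp
  then show "coeff (rev_star (Suc m) (pCons 0 p - smult c (rev_star m p))) k
      = coeff (rev_star m p - smult (cnj c) (pCons 0 p)) k"
    by (cases k) (auto simp: coeff_rev_star coeff_pCons Suc_diff_le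
        intro!: arg_cong[of _ _ "coeff p"] split: nat.splits)
qed

lemma rev_star_OPUC_Suc:
  "rev_star (Suc m) (OPUC a (Suc m))
    = rev_star m (OPUC a m) - smult (a m) (pCons 0 (OPUC a m))"
  using rev_star_Szego_step[of "OPUC a m" m "cnj (a m)"] OPUC_monic[of a m] by simp

definition cap :: "real \<Rightarrow> complex set" where
  "cap s = {w. cmod w < 1 \<and> - s < Re w}"

definition lens :: "real \<Rightarrow> complex set" where
  "lens s = {v. cmod v \<le> 1 \<and> s * (cmod v)\<^sup>2 \<le> Re v}"

lemma one_plus_times_disk_nonzero:
  assumes "cmod w < 1" "0 \<le> c" "c \<le> 1"
  shows "1 + of_real c * w \<noteq> 0"
proof
  assume "1 + of_real c * w = 0"
  then have "of_real c * w = - 1" by (rule minus_unique[symmetric])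
  then have "cmod (of_real c * w) = 1" by simp
  moreover have "c * cmod w \<le> 1 * cmod w" using assms by (intro mult_right_mono) auto
  ultimately show False using assms by (simp add: norm_mult)
qed

text \<open>
  The first step of the invariance. After clearing the denominator the claim is polynomial in
  \<open>x = Re w\<close> and \<open>y = Im w\<close>, and it is sharp: for \<open>c = s\<close> the whole line \<open>x = - s\<close> goes to the
  boundary circle of the lens.
\<close>

lemma translation_maps_cap:
  assumes "w \<in> cap s" "0 \<le> s" "s \<le> c" "c < 1"
  shows "(w + of_real c) / (1 + of_real c * w) \<in> lens s"
proof -
  define x y where "x = Re w" and "y = Im w"
  have w: "cmod w < 1" "- s < x" using assms(1) by (auto simp: cap_def x_def)
  have ne: "1 + of_real c * w \<noteq> 0"
    using assms w by (intro one_plus_times_disk_nonzero) auto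
  have wsq: "x\<^sup>2 + y\<^sup>2 < 1"
    using w(1) power_strict_mono[of "cmod w" 1 2] by (simp add: cmod_power2 x_def y_def)
  define N where "N = (x + c)\<^sup>2 + y\<^sup>2"
  define M where "M = (1 + c * x)\<^sup>2 + (c * y)\<^sup>2"
  have num: "(cmod (w + of_real c))\<^sup>2 = N" and den: "(cmod (1 + of_real c * w))\<^sup>2 = M"
    by (simp_all add: cmod_power2 N_def M_def x_def y_def)
  have Mpos: "M > 0" using ne by (simp flip: den)
  have "M - N = (1 - (x\<^sup>2 + y\<^sup>2)) * (1 - c\<^sup>2)"
    unfolding M_def N_def by algebra
  moreover have "c\<^sup>2 \<le> 1" using assms by (simp add: power_le_one)
  then have "0 \<le> (1 - (x\<^sup>2 + y\<^sup>2)) * (1 - c\<^sup>2)" using wsq by (intro mult_nonneg_nonneg) auto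
  ultimately have "N \<le> M" by linarith
  then have "cmod (w + of_real c) \<le> cmod (1 + of_real c * w)"
    unfolding num[symmetric] den[symmetric] by (rule power2_le_imp_le) simp
  then have le1: "cmod ((w + of_real c) / (1 + of_real c * w)) \<le> 1"
    using ne by (simp add: norm_divide divide_le_eq_1)
  \<comment> \<open>Taylor expansion in \<open>x\<close> about the boundary value \<open>x = - s\<close>: every coefficient is nonnegative.\<close>
  have "(x + c) * (1 + c * x) + c * y\<^sup>2 - s * N
      = (c - s) * (x + s)\<^sup>2 + (1 - c\<^sup>2 + 2 * (c - s)\<^sup>2) * (x + s)
        + (c - s) * ((1 - s)\<^sup>2 + 2 * s * (1 - c)) + (c - s) * y\<^sup>2"
    by (simp add: N_def algebra_simps power2_eq_square)
  also have "\<dots> \<ge> 0"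
  proof -
    have "0 \<le> x + s" "0 \<le> c - s" "0 \<le> 2 * s * (1 - c)"
      "0 \<le> 1 - c\<^sup>2 + 2 * (c - s)\<^sup>2"
      using assms w(2) \<open>c\<^sup>2 \<le> 1\<close> by auto
    then show ?thesis by simp
  qed
  finally have key: "s * N \<le> (x + c) * (1 + c * x) + c * y\<^sup>2" by simp
  have Re: "Re ((w + of_real c) / (1 + of_real c * w)) = ((x + c) * (1 + c * x) + c * y\<^sup>2) / M"
    by (simp add: Re_divide M_def x_def y_def power2_eq_square)
  have "s * (cmod ((w + of_real c) / (1 + of_real c * w)))\<^sup>2 = s * N / M"
    by (simp add: norm_divide power_divide num den)
  also have "\<dots> \<le> ((x + c) * (1 + c * x) + c * y\<^sup>2) / M"
    using key Mpos by (intro divide_right_mono) auto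
  finally show ?thesis using le1 Re by (simp add: lens_def)
qed

text \<open>
  Write \<open>v = x + i y\<close>, \<open>q = \<bar>v\<bar>\<^sup>2\<close> and \<open>z = r exp (i \<theta>)\<close>. In the lens \<open>x \<ge> s q\<close>, hence
  \<open>y\<^sup>2 \<le> q (1 - s\<^sup>2 q)\<close>; in the sector \<open>cos \<theta> \<ge> 1 - 2 s\<^sup>2\<close>, hence \<open>sin\<^sup>2 \<theta> \<le> 4 s\<^sup>2 (1 - s\<^sup>2)\<close>. So
  \<open>\<bar>y sin \<theta>\<bar>\<close> is at most \<open>2 s\<close> times the geometric mean of \<open>q (1 - s\<^sup>2)\<close> and \<open>1 - s\<^sup>2 q\<close>, and
  \<open>s\<close> times the sum of these two numbers is \<open>s q (1 - 2 s\<^sup>2) + s\<close>, which is at most \<open>x cos \<theta> + s\<close>.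
\<close>

lemma sector_times_lens_in_cap:
  assumes z: "z \<in> disk_sector (2 * arcsin s)" and v: "v \<in> lens s"
    and s: "0 < s" "s\<^sup>2 \<le> 1/2"
  shows "z * v \<in> cap s"
proof -
  obtain r \<theta> where zr: "z = rcis r \<theta>" and r: "0 \<le> r" "r < 1"
    and \<theta>: "- (2 * arcsin s) < \<theta>" "\<theta> < 2 * arcsin s"
    using z by (auto simp: disk_sector_def)
  define x y q where "x = Re v" and "y = Im v" and "q = (cmod v)\<^sup>2"
  have q: "q = x\<^sup>2 + y\<^sup>2" by (simp add: q_def x_def y_def cmod_power2)
  have x: "s * q \<le> x" and v1: "cmod v \<le> 1" using v by (auto simp: lens_def x_def q_def)
  have q01: "0 \<le> q" "q \<le> 1" using v1 by (auto simp: q_def power_le_one)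
  have x0: "0 \<le> x" using x s q01 mult_nonneg_nonneg[of s q] by linarith
  have s1: "s \<le> 1" using s(2) power2_le_imp_le[of s 1] by simp
  have sq1: "s\<^sup>2 * q \<le> 1 * 1" using s q01 by (intro mult_mono) auto
  have "cos \<bar>\<theta>\<bar> \<ge> cos (2 * arcsin s)"
    using \<theta> arcsin_bounded[of s] s s1 by (intro cos_monotone_0_pi_le) auto
  then have cos: "1 - 2 * s\<^sup>2 \<le> cos \<theta>"
    using s s1 by (simp add: cos_double_sin)
  have "(1 - 2 * s\<^sup>2)\<^sup>2 \<le> (cos \<theta>)\<^sup>2" using cos s by (intro power_mono) auto
  then have sin: "(sin \<theta>)\<^sup>2 \<le> 4 * s\<^sup>2 * (1 - s\<^sup>2)"
    unfolding sin_squared_eq by (simp add: algebra_simps power2_eq_square)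
  have "(s * q)\<^sup>2 \<le> x\<^sup>2" using x s q01 by (intro power_mono) auto
  then have y: "y\<^sup>2 \<le> q * (1 - s\<^sup>2 * q)" using q by (simp add: algebra_simps power2_eq_square)
  define A B where "A = q * (1 - s\<^sup>2)" and "B = 1 - s\<^sup>2 * q"
  have AB: "0 \<le> A" "0 \<le> B" using s q01 sq1 by (auto simp: A_def B_def)
  have "(y * sin \<theta>)\<^sup>2 \<le> (q * (1 - s\<^sup>2 * q)) * (4 * s\<^sup>2 * (1 - s\<^sup>2))"
    unfolding power_mult_distrib using y sin q01 sq1 by (intro mult_mono) auto
  also have "\<dots> = s\<^sup>2 * (4 * A * B)" by (simp add: A_def B_def)
  also have "\<dots> \<le> s\<^sup>2 * (A + B)\<^sup>2"
    using sum_squares_ge_zero[of "A - B" 0] by (intro mult_left_mono) (auto simp: algebra_simps power2_eq_square)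
  finally have "(y * sin \<theta>)\<^sup>2 \<le> (s * (A + B))\<^sup>2" by (simp add: power_mult_distrib)
  then have "y * sin \<theta> \<le> s * (A + B)" by (rule power2_le_imp_le) (use s AB in auto)
  also have "\<dots> = s * q * (1 - 2 * s\<^sup>2) + s" by (simp add: A_def B_def algebra_simps)
  also have "s * q * (1 - 2 * s\<^sup>2) \<le> x * cos \<theta>"
    using x cos s q01 x0 by (intro mult_mono) auto
  finally have turned: "- s \<le> x * cos \<theta> - y * sin \<theta>" by simp
  \<comment> \<open>This bound becomes an equality at a corner of the lens when \<open>\<theta>\<close> tends to the end of
    the sector; a strict inequality comes from \<open>r < 1\<close>.\<close>
  have "- s < r * (- s)" using r s by simp
  also have "\<dots> \<le> r * (x * cos \<theta> - y * sin \<theta>)" using turned r by (intro mult_left_mono) auto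
  also have "\<dots> = Re (z * v)" by (simp add: zr x_def y_def algebra_simps)
  finally have "- s < Re (z * v)" .
  moreover have "r * cmod v \<le> r * 1" using r v1 by (intro mult_left_mono) auto
  then have "cmod (z * v) < 1" using r by (simp add: zr norm_mult)
  ultimately show ?thesis by (simp add: cap_def)
qed

text \<open>
  The invariance argument. Nonvanishing of \<open>\<Phi>\<^sub>m\<^sup>*\<close> is part of the induction: the reversed
  recursion reads \<open>\<Phi>\<^sub>m\<^sub>+\<^sub>1\<^sup>* = \<Phi>\<^sub>m\<^sup>* (1 + c\<^sub>m g\<^sub>m)\<close>, and \<open>\<bar>g\<^sub>m\<bar> < 1\<close>.
\<close>

lemma Szego_ratio_in_cap:
  assumes z: "z \<in> disk_sector (2 * arcsin s)" and s: "0 < s" "s\<^sup>2 \<le> 1/2"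
    and a: "\<And>j. j < m \<Longrightarrow> a j \<in> complex_of_real ` {-1<..-s}"
  shows "poly (rev_star m (OPUC a m)) z \<noteq> 0 \<and>
    z * (poly (OPUC a m) z / poly (rev_star m (OPUC a m)) z) \<in> cap s"
  using a
proof (induction m)
  case 0
  have "s \<le> 1" using s(2) power2_le_imp_le[of s 1] by simp
  then have "1 \<in> lens s" by (simp add: lens_def)
  from sector_times_lens_in_cap[OF z this s] show ?case by (simp add: rev_star_def)
next
  case (Suc m)
  define P Q where "P = poly (OPUC a m) z" and "Q = poly (rev_star m (OPUC a m)) z"
  define g where "g = z * (P / Q)"
  have Q: "Q \<noteq> 0" and g: "g \<in> cap s"
    using Suc.IH Suc.prems unfolding P_def Q_def g_def by auto
  obtain c where c: "s \<le> c" "c < 1" and am: "a m = of_real (- c)"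
  proof -
    obtain t where "a m = of_real t" "-1 < t" "t \<le> - s" using Suc.prems[of m] by auto
    then show ?thesis using that[of "- t"] by auto
  qed
  have ne: "1 + of_real c * g \<noteq> 0"
    using g c s by (intro one_plus_times_disk_nonzero) (auto simp: cap_def)
  have Qg: "Q * g = z * P" using Q by (simp add: g_def)
  have P': "poly (OPUC a (Suc m)) z = Q * (g + of_real c)"
    using Qg by (simp add: am P_def[symmetric] Q_def[symmetric] algebra_simps)
  have "poly (rev_star (Suc m) (OPUC a (Suc m))) z = Q + of_real c * (z * P)"
    unfolding rev_star_OPUC_Suc by (simp add: am P_def Q_def)
  then have Q': "poly (rev_star (Suc m) (OPUC a (Suc m))) z = Q * (1 + of_real c * g)"
    unfolding Qg[symmetric] by (simp add: algebra_simps)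
  have "z * ((g + of_real c) / (1 + of_real c * g)) \<in> cap s"
    using translation_maps_cap[OF g _ c] s z by (intro sector_times_lens_in_cap) auto
  then show ?case unfolding P' Q' using Q ne by simp
qed

theorem theorem4p2:
  fixes \<alpha> :: real and a :: "nat \<Rightarrow> complex" and n :: nat
  assumes "\<alpha> \<in> {-1/2<..<0}"
    and "n \<ge> 1"
    and "\<And>j. cmod (a j) < 1"
    and "\<And>j. j < n - 1 \<Longrightarrow> a j \<in> complex_of_real ` {-1<..<\<alpha>}"
    and "a (n - 1) = complex_of_real \<alpha>"
  shows "\<forall>z \<in> disk_sector (2 * arcsin \<bar>\<alpha>\<bar>). poly (OPUC a n) z \<noteq> 0"
proof
  fix z assume z: "z \<in> disk_sector (2 * arcsin \<bar>\<alpha>\<bar>)"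
  obtain m where n: "n = Suc m" using assms(2) by (cases n) auto
  have \<alpha>: "-1/2 < \<alpha>" "\<alpha> < 0" using assms(1) by auto
  have "\<bar>\<alpha>\<bar>\<^sup>2 \<le> (1/2)\<^sup>2" using \<alpha> by (intro power_mono) auto
  then have small: "\<bar>\<alpha>\<bar>\<^sup>2 \<le> 1/2" by (simp add: power2_eq_square)
  have coeffs: "a j \<in> complex_of_real ` {-1<..-\<bar>\<alpha>\<bar>}" if "j < m" for j
    using assms(4)[of j] that n \<alpha> by auto
  define P Q where "P = poly (OPUC a m) z" and "Q = poly (rev_star m (OPUC a m)) z"
  have Q: "Q \<noteq> 0" and g: "z * (P / Q) \<in> cap \<bar>\<alpha>\<bar>"
    using Szego_ratio_in_cap[OF z _ small coeffs] \<alpha> unfolding P_def Q_def by auto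
  have "poly (OPUC a n) z = z * P - of_real \<alpha> * Q"
    using assms(5) by (simp add: n P_def Q_def)
  moreover have "z * P \<noteq> of_real \<alpha> * Q"
  proof
    assume "z * P = of_real \<alpha> * Q"
    then have "z * (P / Q) = of_real \<alpha>" using Q by (simp add: field_simps)
    then show False using g \<alpha> by (simp add: cap_def)
  qed
  ultimately show "poly (OPUC a n) z \<noteq> 0" by simp
qed

end
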